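(* Let $\kappa<0$, $n\in\{1,2,\dots\}$, $\nu\in\{+,-\}$, and let $u$ be an $S_n^\nu$-solution, for some $\lambda\in(0,\infty)$, of $$-u''(x)=\lambda u(x)\,[1+\kappa (u'(x))^2]^{3/2},\quad 0<x<1,\qquad u(0)=u(1)=0.$$ Then $n^2\pi^2<\lambda<\infty$. Moreover: (1) All the positive bumps of $u$ have the same shape, and any such bump $B$ satisfies: (i) $B$ is symmetric about its mid-point $m_B$; (ii) $u'$ is strictly decreasing on $B$, so $B$ contains exactly one zero of $u'$, at $m_B$. (2) All the negative bumps of $u$ have the same shape, and any such bump $D$ satisfies: (i) $D$ is symmetric about its mid-point $m_D$; (ii) $u'$ is strictly increasing on $D$, so $D$ contains exactly one zero of $u'$, at $m_D$. (3) The positive and negative bumps have the same shape.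
   Context: $C^1_0[0,1]$ is the space of $C^1$ functions on $[0,1]$ vanishing at $0$ and $1$. For $n\in\{1,2,\dots\}$ and $\nu\in\{+,-\}$, $$S_n^\nu:=\{u\in C_0^1[0,1] : u \text{ has exactly } n-1 \text{ simple zeros in } (0,1), \text{ and } \nu u \text{ is positive near } 0\}$$ (positive near $0$ means on some interval $(0,\varepsilon)$; $\nu$ is identified with $\pm1$). A zero $\tau$ of $u$ is simple if $u'(\tau)\neq0$. An $S_n^\nu$-solution is a (classical, $C^2$) solution $u$, with $1+\kappa (u')^2>0$ on $[0,1]$, such that $u\in S_n^\nu$. A positive (negative) bump of $u$ is (the restriction of $u$ to) a maximal interval on which $u>0$ ($u<0$). A bump on an interval $(x_l,x_r)$ is symmetric about its mid-point if $u(x)=u(x_l+x_r-x)$ there. Two bumps of the same sign have the same shape if one is a translate in $x$ of the other; a positive and a negative bump have the same shape if one is a translate in $x$ of the negative of the other. *)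

theory Defs
  imports "HOL-Analysis.Analysis"
begin

text \<open>
  A function on $[0,1]$ is represented by a total function on the reals of which only the values
  on $[0,1]$ matter. Derivatives are taken within $[0,1]$, hence are one-sided at the end points.
  (The library's \<open>C1_differentiable_on\<close> uses two-sided derivatives and would therefore
  depend on values outside $[0,1]$.)
\<close>

definition D01 :: "(real \<Rightarrow> real) \<Rightarrow> real \<Rightarrow> real" where
  "D01 u x = vector_derivative u (at x within {0..1})"

definition C1_01 :: "(real \<Rightarrow> real) set" where
  "C1_01 = {u. u differentiable_on {0..1} \<and> continuous_on {0..1} (D01 u)}"

definition C2_01 :: "(real \<Rightarrow> real) set" where
  "C2_01 = {u \<in> C1_01. D01 u \<in> C1_01}"

definition C1_0_01 :: "(real \<Rightarrow> real) set" where
  "C1_0_01 = {u \<in> C1_01. u 0 = 0 \<and> u 1 = 0}"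

definition simple_zero :: "(real \<Rightarrow> real) \<Rightarrow> real \<Rightarrow> bool" where
  "simple_zero u \<tau> \<longleftrightarrow> u \<tau> = 0 \<and> D01 u \<tau> \<noteq> 0"

text \<open>The sign \<open>\<nu>\<close> is identified with the real number 1 or -1.\<close>

definition S_nodal :: "nat \<Rightarrow> real \<Rightarrow> (real \<Rightarrow> real) set" where
  "S_nodal n \<nu> = {u \<in> C1_0_01.
     finite {\<tau> \<in> {0<..<1}. simple_zero u \<tau>} \<and>
     card {\<tau> \<in> {0<..<1}. simple_zero u \<tau>} = n - 1 \<and>
     (\<forall>\<^sub>F x in at_right 0. \<nu> * u x > 0)}"

definition is_solution :: "real \<Rightarrow> real \<Rightarrow> (real \<Rightarrow> real) \<Rightarrow> bool" where
  "is_solution \<kappa> lam u \<longleftrightarrow>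
     u \<in> C2_01 \<and>
     (\<forall>x\<in>{0..1}. 1 + \<kappa> * (D01 u x)\<^sup>2 > 0) \<and>
     (\<forall>x\<in>{0<..<1}. - D01 (D01 u) x = lam * u x * (1 + \<kappa> * (D01 u x)\<^sup>2) powr (3/2)) \<and>
     u 0 = 0 \<and> u 1 = 0"

definition S_solution :: "real \<Rightarrow> real \<Rightarrow> nat \<Rightarrow> real \<Rightarrow> (real \<Rightarrow> real) \<Rightarrow> bool" where
  "S_solution \<kappa> lam n \<nu> u \<longleftrightarrow> is_solution \<kappa> lam u \<and> u \<in> S_nodal n \<nu>"

text \<open>
  Bumps are given by the end points of the underlying interval. If \<open>u\<close> is continuous and vanishes
  at 0 and 1, every nonempty maximal subinterval of $[0,1]$ on which \<open>u > 0\<close> is open,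
  so considering open intervals loses nothing; maximality is among intervals of every kind.
\<close>

definition positive_bump :: "(real \<Rightarrow> real) \<Rightarrow> real \<Rightarrow> real \<Rightarrow> bool" where
  "positive_bump u a b \<longleftrightarrow>
     a < b \<and> {a<..<b} \<subseteq> {0..1} \<and> (\<forall>x\<in>{a<..<b}. u x > 0) \<and>
     (\<forall>J. is_interval J \<and> {a<..<b} \<subseteq> J \<and> J \<subseteq> {0..1} \<and> (\<forall>x\<in>J. u x > 0) \<longrightarrow> J = {a<..<b})"

definition negative_bump :: "(real \<Rightarrow> real) \<Rightarrow> real \<Rightarrow> real \<Rightarrow> bool" where
  "negative_bump u = positive_bump (\<lambda>x. - u x)"

definition symmetric_bump :: "(real \<Rightarrow> real) \<Rightarrow> real \<Rightarrow> real \<Rightarrow> bool" where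
  "symmetric_bump u a b \<longleftrightarrow> (\<forall>x\<in>{a<..<b}. u x = u (a + b - x))"

text \<open>The restriction of \<open>v\<close> to $(c,d)$ is a translate of the restriction of \<open>u\<close> to $(a,b)$.\<close>

definition is_translate ::
    "(real \<Rightarrow> real) \<Rightarrow> real \<Rightarrow> real \<Rightarrow> (real \<Rightarrow> real) \<Rightarrow> real \<Rightarrow> real \<Rightarrow> bool" where
  "is_translate u a b v c d \<longleftrightarrow>
     (\<exists>h. c = a + h \<and> d = b + h \<and> (\<forall>x\<in>{a<..<b}. v (x + h) = u x))"

definition same_shape :: "(real \<Rightarrow> real) \<Rightarrow> real \<Rightarrow> real \<Rightarrow> real \<Rightarrow> real \<Rightarrow> bool" where
  "same_shape u a b c d \<longleftrightarrow> is_translate u a b u c d"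

definition same_shape_opposite :: "(real \<Rightarrow> real) \<Rightarrow> real \<Rightarrow> real \<Rightarrow> real \<Rightarrow> real \<Rightarrow> bool" where
  "same_shape_opposite u a b c d \<longleftrightarrow> is_translate u a b (\<lambda>x. - u x) c d"

end

theory Submission
  imports Defs
begin

text \<open>
  Put \<open>k = -\<kappa> > 0\<close> and \<open>p = u' / sqrt (1 - k u'\<^sup>2)\<close>, the relativistic momentum belonging to the
  velocity \<open>u'\<close>. The equation then becomes the autonomous Hamiltonian system
  \<open>u' = p / sqrt (1 + k p\<^sup>2)\<close>, \<open>p' = - \<lambda> u\<close>, whose right-hand side is globally Lipschitz.
  So solutions of initial value problems are unique, and \<open>sqrt (1 + k p\<^sup>2) + k \<lambda> u\<^sup>2 / 2\<close> is
  conserved. In particular \<open>p\<^sup>2\<close> has the same nonzero value at all zeros of \<open>u\<close>, so that all zeros are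
  simple, and the system is invariant under \<open>(u, p) \<mapsto> (-u, -p)\<close>, under translation of \<open>x\<close>, and
  under the reversal \<open>(u, p) \<mapsto> (u, -p)\<close> combined with \<open>x \<mapsto> a + b - x\<close>.

  A bump is a trajectory that leaves \<open>u = 0\<close> with a momentum determined by the energy and returns
  to \<open>u = 0\<close> with the opposite momentum. Uniqueness applied to a translated (and, for a negative
  bump, negated) bump gives equality of shapes (\<open>arch_translate\<close>); applied to the reflected bump it
  gives the symmetry (\<open>arch_reflect\<close>). Monotonicity of \<open>u'\<close> holds because \<open>p' = -\<lambda> u\<close> has a sign.

  For the bound on \<open>\<lambda>\<close>, a bump of length \<open>L\<close> is compared with \<open>\<phi>(x) = sin (\<pi> (x - a) / L)\<close>: since
  \<open>-u'' = \<lambda> u (1 + k p\<^sup>2)\<^bsup>-3/2\<^esup>\<close> and the last factor is smaller than 1 except at the mid-point, the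
  Wronskian \<open>u \<phi>' - u' \<phi>\<close>, which vanishes at both ends, would be strictly decreasing if
  \<open>\<lambda> \<le> \<pi>\<^sup>2 / L\<^sup>2\<close> (\<open>arch_eigenvalue_bound\<close>). As \<open>u\<close> has \<open>n + 1\<close> zeros in \<open>[0,1]\<close>, some bump has
  length \<open>L \<le> 1 / n\<close>, whence \<open>\<lambda> > n\<^sup>2 \<pi>\<^sup>2\<close>.
\<close>

section \<open>The velocity as a function of the momentum\<close>

definition velocity :: "real \<Rightarrow> real \<Rightarrow> real" where
  "velocity k p = p / sqrt (1 + k * p\<^sup>2)"

lemma one_plus_pos: "k > 0 \<Longrightarrow> 1 + k * (p::real)\<^sup>2 > 0"
  by (smt (verit) mult_nonneg_nonneg zero_le_power2)

lemma velocity_deriv: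
  assumes "k > 0"
  shows "(velocity k has_real_derivative 1 / sqrt (1 + k * p\<^sup>2) ^ 3) (at p)"
proof -
  define r where "r = sqrt (1 + k * p\<^sup>2)"
  have r: "r > 0" "r\<^sup>2 = 1 + k * p\<^sup>2"
    using one_plus_pos[OF assms, of p] by (auto simp: r_def)
  have "((\<lambda>p. sqrt (1 + k * p\<^sup>2)) has_real_derivative k * p / r) (at p)"
    using one_plus_pos[OF assms, of p]
    by (auto intro!: derivative_eq_intros simp: r_def field_simps)
  then have "((\<lambda>p. p / sqrt (1 + k * p\<^sup>2)) has_real_derivative (1 * r - p * (k * p / r)) / (r * r)) (at p)"
    using r unfolding r_def by (intro DERIV_divide DERIV_ident) auto
  moreover have "(1 * r - p * (k * p / r)) / (r * r) = 1 / r ^ 3"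
  proof -
    have "1 * r - p * (k * p / r) = (r\<^sup>2 - k * p\<^sup>2) / r"
      using r(1) by (simp add: field_simps power2_eq_square)
    also have "\<dots> = 1 / r"
      using r(2) by simp
    finally show ?thesis
      by (simp add: power3_eq_cube)
  qed
  ultimately show ?thesis
    by (simp add: velocity_def[abs_def] r_def)
qed

lemma velocity_continuous_on [continuous_intros]:
  assumes "k > 0" "continuous_on A p"
  shows "continuous_on A (\<lambda>x. velocity k (p x))"
  using one_plus_pos[OF assms(1)] assms(2) unfolding velocity_def
  by (intro continuous_intros) (auto simp: less_imp_neq[symmetric])

lemma velocity_strict_mono:
  assumes "k > 0" "p < q"
  shows "velocity k p < velocity k q"
proof (rule DERIV_pos_imp_increasing[OF assms(2)])
  fix x
  have "1 / sqrt (1 + k * x\<^sup>2) ^ 3 > 0"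
    using one_plus_pos[OF assms(1), of x] by simp
  then show "\<exists>y. (velocity k has_real_derivative y) (at x) \<and> y > 0"
    using velocity_deriv[OF assms(1)] by blast
qed

lemma velocity_eq_0 [simp]: "k > 0 \<Longrightarrow> velocity k p = 0 \<longleftrightarrow> p = 0"
  using one_plus_pos[of k p] by (simp add: velocity_def)

lemma velocity_minus [simp]: "velocity k (- p) = - velocity k p"
  by (simp add: velocity_def)

lemma velocity_lipschitz:
  assumes "k > 0"
  shows "\<bar>velocity k p - velocity k q\<bar> \<le> \<bar>p - q\<bar>"
proof -
  have "velocity k q - velocity k p \<le> q - p" if "p < q" for p q
  proof -
    have "\<exists>z. z > p \<and> z < q \<and>
        velocity k q - velocity k p = (q - p) * (1 / sqrt (1 + k * z\<^sup>2) ^ 3)"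
      by (intro MVT2[OF that] velocity_deriv[OF assms])
    then obtain z where "velocity k q - velocity k p = (q - p) * (1 / sqrt (1 + k * z\<^sup>2) ^ 3)"
      by blast
    moreover have "1 / sqrt (1 + k * z\<^sup>2) ^ 3 \<le> 1"
      using assms one_plus_pos[OF assms, of z] by (simp add: divide_le_eq_1 one_le_power)
    ultimately show ?thesis
      using that by (metis diff_ge_0_iff_ge less_imp_le mult_left_le)
  qed
  then show ?thesis
    using velocity_strict_mono[OF assms] by (smt (verit))
qed

section \<open>The Hamiltonian system\<close>

text \<open>
  The differential equations are imposed in the open interval only: with continuity up to the ends,
  this determines the trajectory and avoids one-sided derivatives.
\<close>

definition trajectory ::
    "real \<Rightarrow> real \<Rightarrow> real \<Rightarrow> real \<Rightarrow> (real \<Rightarrow> real) \<Rightarrow> (real \<Rightarrow> real) \<Rightarrow> bool" where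
  "trajectory k lam a b u p \<longleftrightarrow>
     continuous_on {a..b} u \<and> continuous_on {a..b} p \<and>
     (\<forall>x\<in>{a<..<b}. (u has_real_derivative velocity k (p x)) (at x) \<and>
                   (p has_real_derivative - lam * u x) (at x))"

lemma trajectory_subset:
  assumes "trajectory k lam a b u p" "a \<le> c" "d \<le> b"
  shows "trajectory k lam c d u p"
proof -
  have "{c..d} \<subseteq> {a..b}" "{c<..<d} \<subseteq> {a<..<b}"
    using assms(2,3) by auto
  then show ?thesis
    using assms(1) unfolding trajectory_def by (meson continuous_on_subset subsetD)
qed

lemma trajectory_uminus:
  assumes "trajectory k lam a b u p"
  shows "trajectory k lam a b (\<lambda>x. - u x) (\<lambda>x. - p x)"
  using assms unfolding trajectory_def
  by (auto intro!: continuous_intros derivative_eq_intros)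

lemma trajectory_shift:
  assumes "trajectory k lam (a + h) (b + h) u p"
  shows "trajectory k lam a b (\<lambda>x. u (x + h)) (\<lambda>x. p (x + h))"
  unfolding trajectory_def
proof (intro conjI ballI)
  show "continuous_on {a..b} (\<lambda>x. u (x + h))" "continuous_on {a..b} (\<lambda>x. p (x + h))"
    using assms unfolding trajectory_def
    by (auto intro!: continuous_intros elim!: continuous_on_compose2)
next
  fix x assume "x \<in> {a<..<b}"
  then have "x + h \<in> {a + h<..<b + h}"
    by simp
  then show "((\<lambda>x. u (x + h)) has_real_derivative velocity k (p (x + h))) (at x)"
    "((\<lambda>x. p (x + h)) has_real_derivative - lam * u (x + h)) (at x)"
    using assms unfolding trajectory_def by (auto simp flip: DERIV_shift)
qed

lemma trajectory_reflect:
  assumes "trajectory k lam a b u p"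
  shows "trajectory k lam a b (\<lambda>x. u (a + b - x)) (\<lambda>x. - p (a + b - x))"
  unfolding trajectory_def
proof (intro conjI ballI)
  show "continuous_on {a..b} (\<lambda>x. u (a + b - x))" "continuous_on {a..b} (\<lambda>x. - p (a + b - x))"
    using assms unfolding trajectory_def
    by (auto intro!: continuous_intros elim!: continuous_on_compose2)
next
  fix x assume "x \<in> {a<..<b}"
  then have x: "a + b - x \<in> {a<..<b}"
    by auto
  have d: "((\<lambda>x. a + b - x) has_real_derivative -1) (at x)"
    by (auto intro!: derivative_eq_intros)
  show "((\<lambda>x. u (a + b - x)) has_real_derivative velocity k (- p (a + b - x))) (at x)"
    using DERIV_chain2[OF _ d, of u "velocity k (p (a + b - x))"] assms x
    by (auto simp: trajectory_def)
  show "((\<lambda>x. - p (a + b - x)) has_real_derivative - lam * u (a + b - x)) (at x)"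
    using DERIV_minus[OF DERIV_chain2[OF _ d, of p "- lam * u (a + b - x)"]] assms x
    by (auto simp: trajectory_def)
qed

text \<open>
  A Gronwall argument: the squared distance \<open>D\<close> of two trajectories satisfies \<open>D' \<le> (1 + \<lambda>) D\<close>
  because the velocity is 1-Lipschitz, so \<open>exp (-(1 + \<lambda>) x) D(x)\<close> is decreasing.
\<close>

lemma trajectory_unique:
  assumes "k > 0" "lam > 0"
    and T1: "trajectory k lam a b u p" and T2: "trajectory k lam a b v q"
    and init: "u a = v a" "p a = q a" and x: "x \<in> {a..b}"
  shows "u x = v x" "p x = q x"
proof -
  define D where "D = (\<lambda>x. (u x - v x)\<^sup>2 + (p x - q x)\<^sup>2)"
  define G where "G = (\<lambda>x. exp (- (1 + lam) * x) * D x)"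
  have "G x \<le> G a"
  proof (cases "a < x")
    case True
    have "\<exists>y. (G has_real_derivative y) (at z) \<and> y \<le> 0" if z: "a < z" "z < x" for z
    proof -
      define D' where "D' = 2 * (u z - v z) * (velocity k (p z) - velocity k (q z))
        + 2 * (p z - q z) * (- lam * u z + lam * v z)"
      have zi: "z \<in> {a<..<b}"
        using z x by auto
      have "(D has_real_derivative D') (at z)"
        using T1 T2 zi unfolding trajectory_def D_def D'_def
        by (auto intro!: derivative_eq_intros simp: algebra_simps)
      then have "(G has_real_derivative exp (- (1 + lam) * z) * (D' - (1 + lam) * D z)) (at z)"
        unfolding G_def by (auto intro!: derivative_eq_intros simp: algebra_simps)
      moreover have "D' \<le> (1 + lam) * D z"
      proof -
        define \<xi> where "\<xi> = u z - v z"
        define \<eta> where "\<eta> = p z - q z"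
        define \<delta> where "\<delta> = velocity k (p z) - velocity k (q z)"
        have "\<bar>\<delta>\<bar> \<le> \<bar>\<eta>\<bar>"
          using velocity_lipschitz[OF assms(1)] by (simp add: \<delta>_def \<eta>_def)
        then have "\<xi> * \<delta> \<le> \<bar>\<xi>\<bar> * \<bar>\<eta>\<bar>"
          by (metis abs_ge_self abs_ge_zero abs_mult mult_left_mono order_trans)
        moreover have "2 * (\<bar>\<xi>\<bar> * \<bar>\<eta>\<bar>) \<le> \<xi>\<^sup>2 + \<eta>\<^sup>2"
          using sum_squares_bound[of "\<bar>\<xi>\<bar>" "\<bar>\<eta>\<bar>"] by simp
        ultimately have "2 * (\<xi> * \<delta>) \<le> \<xi>\<^sup>2 + \<eta>\<^sup>2"
          by linarith
        moreover have "- 2 * (\<xi> * \<eta>) \<le> \<xi>\<^sup>2 + \<eta>\<^sup>2"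
          using sum_squares_bound[of "- \<xi>" "\<eta>"] by simp
        then have "lam * (- 2 * (\<xi> * \<eta>)) \<le> lam * (\<xi>\<^sup>2 + \<eta>\<^sup>2)"
          using assms(2) by (intro mult_left_mono) auto
        moreover have "D' = 2 * (\<xi> * \<delta>) + lam * (- 2 * (\<xi> * \<eta>))"
          unfolding D'_def \<xi>_def \<eta>_def \<delta>_def by (simp add: algebra_simps)
        ultimately have "D' \<le> (\<xi>\<^sup>2 + \<eta>\<^sup>2) + lam * (\<xi>\<^sup>2 + \<eta>\<^sup>2)"
          by linarith
        then show ?thesis
          by (simp add: D_def \<xi>_def \<eta>_def distrib_right)
      qed
      ultimately show ?thesis
        by (intro exI conjI) (auto simp: mult_nonneg_nonpos)
    qed
    moreover have "continuous_on {a..x} u" "continuous_on {a..x} p"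
        "continuous_on {a..x} v" "continuous_on {a..x} q"
      using trajectory_subset[OF T1, of a x] trajectory_subset[OF T2, of a x] x
      by (auto simp: trajectory_def)
    then have "continuous_on {a..x} G"
      unfolding G_def D_def by (intro continuous_intros)
    ultimately show ?thesis
      using DERIV_nonpos_imp_decreasing_open[of a x G] True by auto
  qed (use x in auto)
  then have "exp (- (1 + lam) * x) * D x \<le> 0"
    using init by (simp add: G_def D_def)
  then have "D x \<le> 0"
    by (simp add: mult_le_0_iff)
  then have "(u x - v x)\<^sup>2 = 0 \<and> (p x - q x)\<^sup>2 = 0"
    unfolding D_def by (smt (verit) zero_le_power2)
  then show "u x = v x" "p x = q x"
    by auto
qed

definition energy :: "real \<Rightarrow> real \<Rightarrow> real \<Rightarrow> real \<Rightarrow> real" where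
  "energy k lam u p = sqrt (1 + k * p\<^sup>2) + k * lam / 2 * u\<^sup>2"

lemma energy_conserved:
  assumes "k > 0" and T: "trajectory k lam a b u p" and x: "x \<in> {a..b}"
  shows "energy k lam (u x) (p x) = energy k lam (u a) (p a)"
proof (cases "a < b")
  case True
  have "((\<lambda>x. energy k lam (u x) (p x)) has_real_derivative 0) (at z)" if z: "a < z" "z < b" for z
  proof -
    have d: "(u has_real_derivative velocity k (p z)) (at z)"
        "(p has_real_derivative - lam * u z) (at z)"
      using T z by (auto simp: trajectory_def)
    show ?thesis
      using one_plus_pos[OF assms(1), of "p z"] unfolding energy_def
      by (auto intro!: derivative_eq_intros d simp: velocity_def field_simps)
  qed
  moreover have "continuous_on {a..b} (\<lambda>x. energy k lam (u x) (p x))"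
    using T unfolding trajectory_def energy_def by (auto intro!: continuous_intros)
  ultimately show ?thesis
    using DERIV_isconst2[OF True, of "\<lambda>x. energy k lam (u x) (p x)" x] x by auto
next
  case False
  with x have "x = a"
    by auto
  then show ?thesis
    by simp
qed

lemma energy_at_zeros:
  assumes "k > 0" "energy k lam 0 p = energy k lam 0 q"
  shows "p\<^sup>2 = q\<^sup>2"
  using assms by (simp add: energy_def)

text \<open>
  Both terms of the energy are smallest at the state of rest, so the potential term cannot be larger
  than its value there.
\<close>

lemma energy_rest:
  assumes "k > 0" "lam > 0" "energy k lam u p = energy k lam 0 0"
  shows "u = 0"
proof -
  have "sqrt (1 + k * p\<^sup>2) \<ge> 1"
    using assms(1) by simp
  moreover have "sqrt (1 + k * p\<^sup>2) + k * lam / 2 * u\<^sup>2 = 1"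
    using assms(3) by (simp add: energy_def)
  ultimately have "k * lam / 2 * u\<^sup>2 \<le> 0"
    by linarith
  then show ?thesis
    using assms(1,2) by (simp add: mult_le_0_iff)
qed

section \<open>Arches\<close>

text \<open>
  The abstract form of a positive bump of \<open>u\<close>; a negative bump is an arch of the negated trajectory.
\<close>

definition arch ::
    "real \<Rightarrow> real \<Rightarrow> real \<Rightarrow> real \<Rightarrow> (real \<Rightarrow> real) \<Rightarrow> (real \<Rightarrow> real) \<Rightarrow> bool" where
  "arch k lam a b u p \<longleftrightarrow>
     a < b \<and> trajectory k lam a b u p \<and> u a = 0 \<and> u b = 0 \<and> (\<forall>x\<in>{a<..<b}. u x > 0)"

lemma arch_momentum_decreasing:
  assumes "lam > 0" and A: "arch k lam a b u p" and xy: "a \<le> x" "x < y" "y \<le> b"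
  shows "p y < p x"
proof (rule DERIV_neg_imp_decreasing_open[OF xy(2)])
  show "continuous_on {x..y} p"
    using trajectory_subset[of k lam a b u p x y] A xy by (auto simp: arch_def trajectory_def)
  show "\<exists>d. (p has_real_derivative d) (at z) \<and> d < 0" if "x < z" "z < y" for z
  proof -
    have "z \<in> {a<..<b}"
      using that xy by auto
    then have "(p has_real_derivative - lam * u z) (at z)" "- lam * u z < 0"
      using A \<open>lam > 0\<close> by (auto simp: arch_def trajectory_def)
    then show ?thesis
      by blast
  qed
qed

lemma arch_top:
  assumes "k > 0" and A: "arch k lam a b u p"
  obtains m where "a < m" "m < b" "p m = 0"
proof -
  have "\<exists>z. a < z \<and> z < b \<and> (u has_real_derivative 0) (at z)"
    using A by (intro Rolle) (auto simp: arch_def trajectory_def real_differentiable_def)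
  then obtain m where m: "a < m" "m < b" "(u has_real_derivative 0) (at m)"
    by blast
  then have "velocity k (p m) = 0"
    using A DERIV_unique[OF m(3)] by (auto simp: arch_def trajectory_def)
  then show thesis
    using that m \<open>k > 0\<close> by auto
qed

lemma arch_momentum_ends:
  assumes "k > 0" "lam > 0" and A: "arch k lam a b u p"
  shows "p a > 0" "p b = - p a"
proof -
  obtain m where m: "a < m" "m < b" "p m = 0"
    using arch_top[OF assms(1) A] .
  show pa: "p a > 0"
    using arch_momentum_decreasing[OF assms(2) A, of a m] m by auto
  have pb: "p b < 0"
    using arch_momentum_decreasing[OF assms(2) A, of m b] m by auto
  have T: "trajectory k lam a b u p" and ends: "u a = 0" "u b = 0" and "b \<in> {a..b}"
    using A by (auto simp: arch_def)
  then have "energy k lam 0 (p b) = energy k lam 0 (p a)"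
    using energy_conserved[OF assms(1) T, of b] by simp
  then have "(p b)\<^sup>2 = (p a)\<^sup>2"
    using energy_at_zeros[OF assms(1)] by blast
  with pa pb show "p b = - p a"
    by (auto simp: power2_eq_iff)
qed

text \<open>
  The reversed arch starts from \<open>u = 0\<close> with momentum \<open>- p b = p a\<close>, as the arch itself does.
\<close>

lemma arch_reflect:
  assumes "k > 0" "lam > 0" and A: "arch k lam a b u p" and x: "x \<in> {a..b}"
  shows "u (a + b - x) = u x" "p (a + b - x) = - p x"
proof -
  have T: "trajectory k lam a b u p"
    using A by (simp add: arch_def)
  note U = trajectory_unique[OF assms(1,2) T trajectory_reflect[OF T] _ _ x]
  have "u a = u (a + b - a)" "p a = - p (a + b - a)"
    using A arch_momentum_ends[OF assms(1,2) A] by (auto simp: arch_def)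
  from U[OF this] show "u (a + b - x) = u x" "p (a + b - x) = - p x"
    by auto
qed

lemma arch_shift_agree:
  assumes "k > 0" "lam > 0" and A: "arch k lam a b u p" and B: "arch k lam c d v q"
    and "p a = q c" and le: "b - a \<le> d - c"
  shows "d - c = b - a" "\<And>x. x \<in> {a..b} \<Longrightarrow> v (x + (c - a)) = u x"
proof -
  have "trajectory k lam (a + (c - a)) (b + (c - a)) v q"
    using B le trajectory_subset[of k lam c d v q c "b + (c - a)"] by (simp add: arch_def)
  note S = trajectory_shift[OF this]
  have T: "trajectory k lam a b u p"
    using A by (simp add: arch_def)
  show agree: "v (x + (c - a)) = u x" if "x \<in> {a..b}" for x
    using trajectory_unique(1)[OF assms(1,2) T S _ _ that] A B \<open>p a = q c\<close> by (auto simp: arch_def)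
  \<comment> \<open>The longer arch vanishes where the shorter one ends, hence ends there as well.\<close>
  have "v (b + (c - a)) = 0"
    using agree[of b] A by (auto simp: arch_def)
  then have "\<not> b + (c - a) < d"
    using A B by (auto simp: arch_def dest!: bspec[of _ _ "b + (c - a)"])
  with le show "d - c = b - a"
    by simp
qed

lemma arch_translate:
  assumes "k > 0" "lam > 0" and A: "arch k lam a b u p" and B: "arch k lam c d v q"
    and E: "energy k lam 0 (p a) = energy k lam 0 (q c)"
  shows "is_translate u a b v c d"
proof -
  have "(p a)\<^sup>2 = (q c)\<^sup>2"
    using energy_at_zeros[OF assms(1) E] .
  then have eq: "p a = q c"
    using arch_momentum_ends(1)[OF assms(1,2) A] arch_momentum_ends(1)[OF assms(1,2) B]
    by (auto simp: power2_eq_iff)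
  have len: "d - c = b - a"
    using arch_shift_agree(1)[OF assms(1,2) A B eq]
      arch_shift_agree(1)[OF assms(1,2) B A eq[symmetric]]
    by linarith
  have "v (x + (c - a)) = u x" if "x \<in> {a<..<b}" for x
    using arch_shift_agree(2)[OF assms(1,2) A B eq] len that by auto
  then show ?thesis
    unfolding is_translate_def using len by (intro exI[of _ "c - a"]) auto
qed

text \<open>
  With \<open>\<omega> = \<pi> / (b - a)\<close> and \<open>\<phi>(x) = sin (\<omega> (x - a))\<close>, the Wronskian \<open>W = u \<phi>' - u' \<phi>\<close> vanishes at both
  ends, and \<open>W' = u \<phi> (\<lambda> (1 + k p\<^sup>2)\<^bsup>-3/2\<^esup> - \<omega>\<^sup>2)\<close>. If \<open>\<lambda> \<le> \<omega>\<^sup>2\<close>, this is negative wherever \<open>p \<noteq> 0\<close>, that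
  is, on both sides of the top of the arch.
\<close>

lemma arch_eigenvalue_bound:
  assumes "k > 0" "lam > 0" and A: "arch k lam a b u p"
  shows "pi\<^sup>2 / (b - a)\<^sup>2 < lam"
proof (rule ccontr)
  define \<omega> where "\<omega> = pi / (b - a)"
  assume "\<not> pi\<^sup>2 / (b - a)\<^sup>2 < lam"
  then have lam_le: "lam \<le> \<omega>\<^sup>2"
    by (simp add: \<omega>_def power_divide)
  have ab: "a < b"
    using A by (simp add: arch_def)
  have \<omega>: "\<omega> > 0" "\<omega> * (b - a) = pi"
    using ab by (auto simp: \<omega>_def)
  define W where "W = (\<lambda>x. u x * (\<omega> * cos (\<omega> * (x - a))) - velocity k (p x) * sin (\<omega> * (x - a)))"
  obtain m where m: "a < m" "m < b" "p m = 0"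
    using arch_top[OF assms(1) A] .
  have W': "\<exists>y. (W has_real_derivative y) (at x) \<and> y < 0" if x: "x \<in> {a<..<b}" "p x \<noteq> 0" for x
  proof -
    define r where "r = sqrt (1 + k * (p x)\<^sup>2)"
    define s where "s = sin (\<omega> * (x - a))"
    have d: "(u has_real_derivative velocity k (p x)) (at x)"
        "(p has_real_derivative - lam * u x) (at x)"
      using A x by (auto simp: arch_def trajectory_def)
    have dv: "((\<lambda>x. velocity k (p x)) has_real_derivative 1 / r ^ 3 * (- lam * u x)) (at x)"
      unfolding r_def by (intro DERIV_chain2[OF velocity_deriv[OF assms(1)] d(2)])
    have "(W has_real_derivative u x * s * (lam / r ^ 3 - \<omega>\<^sup>2)) (at x)"
      unfolding W_def
      by (auto intro!: derivative_eq_intros d dv simp: s_def power2_eq_square algebra_simps)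
    moreover have "u x * s * (lam / r ^ 3 - \<omega>\<^sup>2) < 0"
    proof -
      have "\<omega> * (x - a) < \<omega> * (b - a)"
        using \<omega>(1) x by (intro mult_strict_left_mono) auto
      then have "s > 0"
        unfolding s_def using \<omega> x by (intro sin_gt_zero) auto
      moreover have "u x > 0"
        using A x by (auto simp: arch_def)
      moreover have "r > 1"
        using x assms(1) by (simp add: r_def)
      then have "r ^ 3 > 1"
        by (intro one_less_power) auto
      then have "lam / r ^ 3 < lam"
        using assms(2) \<open>r > 1\<close> by (simp add: divide_less_eq)
      ultimately show ?thesis
        using lam_le by (intro mult_pos_neg) auto
    qed
    ultimately show ?thesis
      by blast
  qed
  have cont: "continuous_on {a..b} W"
    using A unfolding W_def arch_def trajectory_def
    by (intro continuous_intros assms(1)) auto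
  have "W m < W a"
  proof (rule DERIV_neg_imp_decreasing_open[OF m(1)])
    fix x assume x: "a < x" "x < m"
    show "\<exists>y. (W has_real_derivative y) (at x) \<and> y < 0"
      using W' x m arch_momentum_decreasing[OF assms(2) A, of x m] by auto
  qed (use cont m in \<open>auto intro: continuous_on_subset\<close>)
  moreover have "W b < W m"
  proof (rule DERIV_neg_imp_decreasing_open[OF m(2)])
    fix x assume x: "m < x" "x < b"
    show "\<exists>y. (W has_real_derivative y) (at x) \<and> y < 0"
      using W' x m arch_momentum_decreasing[OF assms(2) A, of m x] by auto
  qed (use cont m in \<open>auto intro: continuous_on_subset\<close>)
  moreover have "W a = 0" "W b = 0"
    using A \<omega>(2) by (auto simp: W_def arch_def)
  ultimately show False
    by simp
qed

section \<open>From the boundary value problem to the Hamiltonian system\<close>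

definition momentum :: "real \<Rightarrow> (real \<Rightarrow> real) \<Rightarrow> real \<Rightarrow> real" where
  "momentum \<kappa> u x = D01 u x / sqrt (1 + \<kappa> * (D01 u x)\<^sup>2)"

lemma D01_deriv:
  assumes "u \<in> C1_01" "x \<in> {0<..<1}"
  shows "(u has_real_derivative D01 u x) (at x)"
proof -
  have "(u has_vector_derivative D01 u x) (at x within {0..1})"
    using assms unfolding D01_def C1_01_def differentiable_on_def
    by (auto simp flip: vector_derivative_works)
  then show ?thesis
    using assms(2) by (simp add: has_real_derivative_iff_has_vector_derivative at_within_Icc_at)
qed

lemma velocity_momentum:
  assumes "1 + \<kappa> * (D01 u x)\<^sup>2 > 0"
  shows "velocity (- \<kappa>) (momentum \<kappa> u x) = D01 u x"
proof -
  define w where "w = 1 + \<kappa> * (D01 u x)\<^sup>2"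
  have w: "w > 0"
    using assms by (simp add: w_def)
  have "1 + - \<kappa> * (momentum \<kappa> u x)\<^sup>2 = (w - \<kappa> * (D01 u x)\<^sup>2) / w"
    using w unfolding momentum_def w_def[symmetric] by (simp add: power_divide field_simps)
  also have "\<dots> = 1 / w"
    by (simp add: w_def)
  finally have "sqrt (1 + - \<kappa> * (momentum \<kappa> u x)\<^sup>2) = 1 / sqrt w"
    by (simp add: real_sqrt_divide)
  then show ?thesis
    using w by (simp add: velocity_def momentum_def w_def)
qed

text \<open>
  The momentum is chosen so that \<open>p' = u'' (1 + \<kappa> u'\<^sup>2)\<^bsup>-3/2\<^esup>\<close>; the differential equation turns the
  right-hand side into \<open>- \<lambda> u\<close>.
\<close>

lemma solution_trajectory:
  assumes "is_solution \<kappa> lam u"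
  shows "trajectory (- \<kappa>) lam 0 1 u (momentum \<kappa> u)"
  unfolding trajectory_def
proof (intro conjI ballI)
  have C: "u \<in> C1_01" "D01 u \<in> C1_01"
    and pos: "\<And>x. x \<in> {0..1} \<Longrightarrow> 1 + \<kappa> * (D01 u x)\<^sup>2 > 0"
    using assms by (auto simp: is_solution_def C2_01_def)
  show "continuous_on {0..1} u"
    using C by (simp add: C1_01_def differentiable_imp_continuous_on)
  have "continuous_on {0..1} (D01 u)"
    using C by (simp add: C1_01_def)
  then show "continuous_on {0..1} (momentum \<kappa> u)"
    using pos unfolding momentum_def
    by (intro continuous_intros) (auto simp: less_imp_neq[symmetric])
  fix x :: real assume x: "x \<in> {0<..<1}"
  then have wpos: "1 + \<kappa> * (D01 u x)\<^sup>2 > 0"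
    using pos by auto
  show "(u has_real_derivative velocity (- \<kappa>) (momentum \<kappa> u x)) (at x)"
    using D01_deriv[OF C(1) x] velocity_momentum[OF wpos] by simp
  define v v' r where "v = D01 u x" and "v' = D01 (D01 u) x" and "r = sqrt (1 + \<kappa> * v\<^sup>2)"
  have r: "r > 0" "r\<^sup>2 = 1 + \<kappa> * v\<^sup>2"
    using wpos by (auto simp: r_def v_def)
  have dv: "(D01 u has_real_derivative v') (at x)"
    using D01_deriv[OF C(2) x] by (simp add: v'_def)
  have "((\<lambda>x. sqrt (1 + \<kappa> * (D01 u x)\<^sup>2)) has_real_derivative \<kappa> * v * v' / r) (at x)"
    using wpos by (auto intro!: derivative_eq_intros dv simp: r_def v_def field_simps)
  then have "(momentum \<kappa> u has_real_derivative (v' * r - v * (\<kappa> * v * v' / r)) / (r * r)) (at x)"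
    using r dv unfolding momentum_def[abs_def] r_def v_def by (intro DERIV_divide) auto
  moreover have "(v' * r - v * (\<kappa> * v * v' / r)) / (r * r) = - lam * u x"
  proof -
    have "(1 + \<kappa> * v\<^sup>2) powr (3/2) = r ^ 3"
    proof -
      have "(1 + \<kappa> * v\<^sup>2) powr (3/2) = (r powr 2) powr (3/2)"
        using r by (simp add: powr_numeral)
      also have "\<dots> = r ^ 3"
        using r(1) by (simp only: powr_powr) (simp add: powr_numeral)
      finally show ?thesis .
    qed
    then have eq: "v' = - lam * u x * r ^ 3"
      using assms x unfolding is_solution_def v_def v'_def
      by (metis minus_mult_left minus_minus)
    have "v' * r - v * (\<kappa> * v * v' / r) = v' * (r\<^sup>2 - \<kappa> * v\<^sup>2) / r"
      using r(1) by (simp add: field_simps power2_eq_square)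
    also have "\<dots> = v' / r"
      using r(2) by simp
    finally show ?thesis
      using r(1) by (simp add: eq power3_eq_cube)
  qed
  ultimately show "(momentum \<kappa> u has_real_derivative - lam * u x) (at x)"
    by simp
qed

text \<open>
  At an end point of the interval of a maximal bump the function must vanish: otherwise the end point
  could be added to the interval.
\<close>

lemma positive_bump_ends:
  assumes cont: "continuous_on {0..1} u" and B: "positive_bump u a b"
  shows "a < b" "0 \<le> a" "b \<le> 1" "u a = 0" "u b = 0" "\<And>x. x \<in> {a<..<b} \<Longrightarrow> u x > 0"
proof -
  show ab: "a < b" and pos: "\<And>x. x \<in> {a<..<b} \<Longrightarrow> u x > 0"
    using B by (auto simp: positive_bump_def)
  have sub: "{a<..<b} \<subseteq> {0..1}"
    and max: "\<And>J. is_interval J \<Longrightarrow> {a<..<b} \<subseteq> J \<Longrightarrow> J \<subseteq> {0..1} \<Longrightarrow> (\<forall>x\<in>J. u x > 0) \<Longrightarrow> J = {a<..<b}"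
    using B by (auto simp: positive_bump_def)
  have "closure {a<..<b} \<subseteq> {0..1}"
    using sub by (intro closure_minimal) auto
  then have icc: "{a..b} \<subseteq> {0..1}"
    using ab by simp
  then show a0: "0 \<le> a" and b1: "b \<le> 1"
    using ab by auto
  have nonneg: "u x \<ge> 0" if "x \<in> {a..b}" for x
  proof (rule continuous_ge_on_closure[of "{a<..<b}" u x 0])
    show "continuous_on (closure {a<..<b}) u"
      using ab continuous_on_subset[OF cont icc] by simp
  qed (use ab that pos in \<open>auto intro: less_imp_le\<close>)
  show "u a = 0"
  proof (rule ccontr)
    assume "u a \<noteq> 0"
    then have "\<forall>x\<in>{a..<b}. u x > 0"
      using nonneg[of a] pos ab by (metis atLeastAtMost_iff atLeastLessThan_iff
        greaterThanLessThan_iff le_less less_eq_real_def)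
    then have "{a..<b} = {a<..<b}"
      using icc ab by (intro max) (auto simp: is_interval_co)
    moreover have "a \<in> {a..<b}"
      using ab by simp
    ultimately show False
      by auto
  qed
  show "u b = 0"
  proof (rule ccontr)
    assume "u b \<noteq> 0"
    then have "\<forall>x\<in>{a<..b}. u x > 0"
      using nonneg[of b] pos ab by (metis atLeastAtMost_iff greaterThanAtMost_iff
        greaterThanLessThan_iff le_less less_eq_real_def)
    then have "{a<..b} = {a<..<b}"
      using icc ab by (intro max) (auto simp: is_interval_oc)
    moreover have "b \<in> {a<..b}"
      using ab by simp
    ultimately show False
      by auto
  qed
qed

lemma positive_bump_arch:
  assumes T: "trajectory k lam 0 1 u p" and B: "positive_bump u a b"
  shows "arch k lam a b u p"
proof -
  have cont: "continuous_on {0..1} u"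
    using T by (simp add: trajectory_def)
  note E = positive_bump_ends[OF cont B]
  show ?thesis
    unfolding arch_def using E trajectory_subset[OF T E(2,3)] by auto
qed

lemma bump_energy:
  assumes "k > 0" and T: "trajectory k lam 0 1 u p" and B: "positive_bump u a b"
  shows "energy k lam 0 (p a) = energy k lam (u 0) (p 0)"
proof -
  have "continuous_on {0..1} u"
    using T by (simp add: trajectory_def)
  note E = positive_bump_ends[OF this B]
  show ?thesis
    using energy_conserved[OF assms(1) T, of a] E by auto
qed

lemma positive_bumps_translate:
  assumes "k > 0" "lam > 0"
    and T1: "trajectory k lam 0 1 u p" and T2: "trajectory k lam 0 1 v q"
    and E: "energy k lam (u 0) (p 0) = energy k lam (v 0) (q 0)"
    and B1: "positive_bump u a b" and B2: "positive_bump v c d"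
  shows "is_translate u a b v c d"
  using arch_translate[OF assms(1,2) positive_bump_arch[OF T1 B1] positive_bump_arch[OF T2 B2]]
    bump_energy[OF assms(1) T1 B1] bump_energy[OF assms(1) T2 B2] E
  by simp

lemma positive_bump_symmetric:
  assumes "k > 0" "lam > 0" and T: "trajectory k lam 0 1 u p" and B: "positive_bump u a b"
  shows "symmetric_bump u a b"
  using arch_reflect(1)[OF assms(1,2) positive_bump_arch[OF T B]]
  by (auto simp: symmetric_bump_def)

lemma positive_bump_velocity_decreasing:
  assumes "k > 0" "lam > 0" and T: "trajectory k lam 0 1 u p" and B: "positive_bump u a b"
  shows "strict_antimono_on {a<..<b} (\<lambda>x. velocity k (p x))"
  using arch_momentum_decreasing[OF assms(2) positive_bump_arch[OF T B]]
    velocity_strict_mono[OF assms(1)]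
  by (auto simp: monotone_on_def)

text \<open>By the symmetry, the momentum at the mid-point is its own negative.\<close>

lemma positive_bump_critical_point:
  assumes "k > 0" "lam > 0" and T: "trajectory k lam 0 1 u p" and B: "positive_bump u a b"
  shows "{x \<in> {a<..<b}. velocity k (p x) = 0} = {(a + b) / 2}"
proof -
  let ?m = "(a + b) / 2"
  note A = positive_bump_arch[OF T B]
  have ab: "a < b"
    using A by (simp add: arch_def)
  have "p (a + b - ?m) = - p ?m"
    using arch_reflect(2)[OF assms(1,2) A, of ?m] ab by auto
  moreover have "a + b - ?m = ?m"
    by (simp add: field_simps)
  ultimately have m: "p ?m = 0"
    by simp
  have "x = ?m" if "x \<in> {a<..<b}" "p x = 0" for x
    using arch_momentum_decreasing[OF assms(2) A, of x ?m]
      arch_momentum_decreasing[OF assms(2) A, of ?m x] that m ab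
    by (cases x ?m rule: linorder_cases) auto
  then show ?thesis
    using m ab assms(1) by auto
qed

section \<open>The lower bound for the parameter\<close>

text \<open>
  Some two points have distance at most \<open>1 / n\<close>: otherwise \<open>t \<mapsto> \<lceil>n t\<rceil>\<close> would map the \<open>n\<close> nonzero
  points injectively to \<open>{2..n}\<close>.
\<close>

lemma close_neighbours:
  fixes Z :: "real set"
  assumes Z: "finite Z" "card Z = n + 1" "n \<ge> 1" "Z \<subseteq> {0..1}" "0 \<in> Z"
  obtains s t where "s \<in> Z" "t \<in> Z" "s < t" "t - s \<le> 1 / real n" "Z \<inter> {s<..<t} = {}"
proof -
  have "\<exists>s\<in>Z. \<exists>t\<in>Z. s < t \<and> t - s \<le> 1 / real n"
  proof (rule ccontr)
    assume "\<not> ?thesis"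
    then have "t - s > 1 / real n" if "s \<in> Z" "t \<in> Z" "s < t" for s t
      using that by (meson not_le)
    then have far: "real n * t > real n * s + 1" if "s \<in> Z" "t \<in> Z" "s < t" for s t
      using that Z(3) by (fastforce simp: field_simps)
    let ?f = "\<lambda>t. \<lceil>real n * t\<rceil>"
    have less: "?f s < ?f t" if "s \<in> Z" "t \<in> Z" "s < t" for s t
      using far[OF that] by linarith
    have inj: "inj_on ?f (Z - {0})"
      by (rule inj_onI) (metis DiffD1 less less_irrefl linorder_cases)
    have "?f t \<in> {2..int n}" if t: "t \<in> Z - {0}" for t
    proof -
      have "0 < t" "t \<le> 1"
        using t Z(4) by fastforce+
      then have "real n * t > 1" "real n * t \<le> real n"
        using far[of 0 t] t Z(5) by (auto simp: mult_left_le)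
      then show ?thesis
        by (simp add: ceiling_le_iff)
    qed
    then have "card (Z - {0}) \<le> card {2..int n}"
      by (intro card_inj_on_le[OF inj]) blast+
    then show False
      using Z by (simp add: card_Diff_singleton)
  qed
  then obtain s t where st: "s \<in> Z" "t \<in> Z" "s < t" "t - s \<le> 1 / real n"
    by blast
  define t' where "t' = Min {z \<in> Z. s < z}"
  have "t' \<in> {z \<in> Z. s < z}"
    unfolding t'_def using st Z(1) by (intro Min_in) auto
  moreover have le: "t' \<le> z" if "z \<in> Z" "s < z" for z
    unfolding t'_def using that Z(1) by (intro Min_le) auto
  moreover have "t' - s \<le> 1 / real n"
    using le[OF st(2,3)] st(4) by linarith
  moreover have "Z \<inter> {s<..<t'} = {}"
    using le by fastforce
  ultimately show thesis
    using that st(1) by blast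
qed

lemma nonvanishing_sign:
  fixes u :: "real \<Rightarrow> real"
  assumes "continuous_on {a<..<b} u" "\<And>x. x \<in> {a<..<b} \<Longrightarrow> u x \<noteq> 0"
  shows "(\<forall>x\<in>{a<..<b}. u x > 0) \<or> (\<forall>x\<in>{a<..<b}. - u x > 0)"
proof (rule ccontr)
  assume "\<not> ?thesis"
  then obtain x y where xy: "x \<in> {a<..<b}" "y \<in> {a<..<b}" "u x \<le> 0" "0 \<le> u y"
    by (metis neg_0_less_iff_less not_le)
  have "connected (u ` {a<..<b})"
    using assms(1) by (intro connected_continuous_image) auto
  then have "0 \<in> u ` {a<..<b}"
    using connectedD_interval[of "u ` {a<..<b}" "u x" "u y" 0] xy by blast
  then show False
    using assms(2) by auto
qed

text \<open>
  Energy conservation makes all zeros of \<open>u\<close> simple, so that \<open>S_nodal\<close> counts all interior zeros.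
\<close>

lemma nontrivial_momentum_at_zero:
  assumes "k > 0" "lam > 0" and T: "trajectory k lam 0 1 u p"
    and y: "y \<in> {0..1}" "u y \<noteq> 0" and x: "x \<in> {0..1}" "u x = 0"
  shows "p x \<noteq> 0"
proof
  assume "p x = 0"
  then have "energy k lam (u y) (p y) = energy k lam 0 0"
    using energy_conserved[OF assms(1) T x(1)] energy_conserved[OF assms(1) T y(1)] x(2) by simp
  then show False
    using energy_rest[OF assms(1,2)] y(2) by blast
qed

text \<open>
  The \<open>n - 1\<close> simple zeros together with 0 and 1 are all the zeros of \<open>u\<close>. Between two consecutive ones
  at distance at most \<open>1 / n\<close> either \<open>u\<close> or \<open>-u\<close> is an arch, whence the fresh names for the trajectory.
\<close>

lemma nodal_short_arch:
  assumes "\<kappa> < 0" "lam > 0" "n \<ge> 1" and S: "S_solution \<kappa> lam n \<nu> u"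
  obtains v q a b where "arch (- \<kappa>) lam a b v q" "b - a \<le> 1 / real n"
proof -
  have sol: "is_solution \<kappa> lam u" and nodal: "u \<in> S_nodal n \<nu>"
    using S by (auto simp: S_solution_def)
  have k: "- \<kappa> > 0"
    using assms(1) by simp
  note T = solution_trajectory[OF sol]
  have u01: "u 0 = 0" "u 1 = 0"
    using sol by (auto simp: is_solution_def)
  have "\<forall>\<^sub>F x in at_right 0. x \<in> {0<..<1::real} \<and> \<nu> * u x > 0"
    using nodal by (intro eventually_conj eventually_at_right_real) (auto simp: S_nodal_def)
  then obtain y where y: "y \<in> {0<..<1}" "\<nu> * u y > 0"
    using eventually_happens'[OF trivial_limit_at_right_real] by blast
  have simple: "simple_zero u x" if "x \<in> {0..1}" "u x = 0" for x
  proof -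
    have "momentum \<kappa> u x \<noteq> 0"
      using nontrivial_momentum_at_zero[OF k assms(2) T, of y x] y that by fastforce
    then show ?thesis
      using that by (auto simp: simple_zero_def momentum_def)
  qed
  define Z where "Z = {x \<in> {0..1}. u x = 0}"
  define Z0 where "Z0 = {x \<in> {0<..<1}. simple_zero u x}"
  have "x \<in> {0<..<1} \<or> x = 0 \<or> x = 1" if "x \<in> {0..1}" for x :: real
    using that by auto
  then have Z: "Z = insert 0 (insert 1 Z0)"
    using simple u01 unfolding Z_def Z0_def by (auto simp: simple_zero_def)
  have Z0: "finite Z0" "card Z0 = n - 1" "0 \<notin> Z0" "1 \<notin> Z0"
    using nodal by (auto simp: S_nodal_def Z0_def)
  have "finite Z" "card Z = n + 1" "Z \<subseteq> {0..1}" "0 \<in> Z"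
    using Z0 assms(3) u01 by (auto simp: Z) (auto simp: Z0_def)
  then obtain s t where st: "s \<in> Z" "t \<in> Z" "s < t" "t - s \<le> 1 / real n" "Z \<inter> {s<..<t} = {}"
    using close_neighbours[of Z n] assms(3) by metis
  have st01: "0 \<le> s" "t \<le> 1" "u s = 0" "u t = 0"
    using st by (auto simp: Z_def)
  note Tst = trajectory_subset[OF T st01(1,2)]
  have "u x \<noteq> 0" if "x \<in> {s<..<t}" for x
  proof
    assume "u x = 0"
    then have "x \<in> Z"
      using that st01 by (auto simp: Z_def)
    then show False
      using st(5) that by blast
  qed
  moreover have "continuous_on {s<..<t} u"
    by (rule continuous_on_subset[of "{s..t}"]) (use Tst in \<open>auto simp: trajectory_def\<close>)
  ultimately consider "\<forall>x\<in>{s<..<t}. u x > 0" | "\<forall>x\<in>{s<..<t}. - u x > 0"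
    using nonvanishing_sign by blast
  then show thesis
  proof cases
    case 1
    then have "arch (- \<kappa>) lam s t u (momentum \<kappa> u)"
      using Tst st01 st(3) by (simp add: arch_def)
    then show thesis
      using that st(4) by blast
  next
    case 2
    then have "arch (- \<kappa>) lam s t (\<lambda>x. - u x) (\<lambda>x. - momentum \<kappa> u x)"
      using trajectory_uminus[OF Tst] st01 st(3) by (simp add: arch_def)
    then show thesis
      using that st(4) by blast
  qed
qed

lemma nodal_eigenvalue_bound:
  assumes "\<kappa> < 0" "lam > 0" "n \<ge> 1" "S_solution \<kappa> lam n \<nu> u"
  shows "(real n)\<^sup>2 * pi\<^sup>2 < lam"
proof -
  obtain v q a b where A: "arch (- \<kappa>) lam a b v q" and le: "b - a \<le> 1 / real n"
    using nodal_short_arch[OF assms] .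
  have ab: "a < b"
    using A by (simp add: arch_def)
  then have "real n * (b - a) \<le> 1"
    using le assms(3) by (simp add: field_simps)
  then have "(real n * (b - a))\<^sup>2 \<le> 1"
    using ab by (simp add: power_le_one)
  then have "(real n * (b - a))\<^sup>2 * pi\<^sup>2 \<le> pi\<^sup>2"
    by (simp add: mult_left_le_one_le)
  then have "(real n)\<^sup>2 * pi\<^sup>2 \<le> pi\<^sup>2 / (b - a)\<^sup>2"
    using ab by (simp add: pos_le_divide_eq power_mult_distrib mult_ac)
  also have "\<dots> < lam"
    using assms A by (intro arch_eigenvalue_bound) auto
  finally show ?thesis .
qed

section \<open>The shape of the solutions\<close>

theorem lemma4p1:
  fixes \<kappa> lam \<nu> :: real and n :: nat and u :: "real \<Rightarrow> real"
  assumes "\<kappa> < 0" and "n \<ge> 1" and "\<nu> \<in> {1, -1}" and "lam > 0"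
    and "S_solution \<kappa> lam n \<nu> u"
  shows "(real n)\<^sup>2 * pi\<^sup>2 < lam \<and>
    ((\<forall>a b c d. positive_bump u a b \<and> positive_bump u c d \<longrightarrow> same_shape u a b c d) \<and>
     (\<forall>a b. positive_bump u a b \<longrightarrow>
        symmetric_bump u a b \<and>
        strict_antimono_on {a<..<b} (D01 u) \<and>
        {x \<in> {a<..<b}. D01 u x = 0} = {(a + b) / 2})) \<and>
    ((\<forall>a b c d. negative_bump u a b \<and> negative_bump u c d \<longrightarrow> same_shape u a b c d) \<and>
     (\<forall>a b. negative_bump u a b \<longrightarrow>
        symmetric_bump u a b \<and>
        strict_mono_on {a<..<b} (D01 u) \<and>
        {x \<in> {a<..<b}. D01 u x = 0} = {(a + b) / 2})) \<and>
    (\<forall>a b c d. positive_bump u a b \<and> negative_bump u c d \<longrightarrow> same_shape_opposite u a b c d)"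
proof -
  have k: "- \<kappa> > 0"
    using assms(1) by simp
  have sol: "is_solution \<kappa> lam u"
    using assms(5) by (simp add: S_solution_def)
  define p where "p = momentum \<kappa> u"
  have T: "trajectory (- \<kappa>) lam 0 1 u p"
    unfolding p_def using solution_trajectory[OF sol] .
  note T' = trajectory_uminus[OF T]
  have E: "energy (- \<kappa>) lam (u 0) (p 0) = energy (- \<kappa>) lam (- u 0) (- p 0)"
    by (simp add: energy_def)
  have vel: "velocity (- \<kappa>) (p x) = D01 u x" if "x \<in> {0..1}" for x
    unfolding p_def using sol that by (intro velocity_momentum) (auto simp: is_solution_def)
  have sub: "{a<..<b} \<subseteq> {0..1}" if "positive_bump v a b" for v a b
    using that by (simp add: positive_bump_def)
  have opposite: "is_translate u a b (\<lambda>x. - u x) c d"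
    if "positive_bump u a b" "negative_bump u c d" for a b c d
    using positive_bumps_translate[OF k assms(4) T T' E] that by (simp add: negative_bump_def)
  have pos: "symmetric_bump u a b \<and> strict_antimono_on {a<..<b} (D01 u) \<and>
      {x \<in> {a<..<b}. D01 u x = 0} = {(a + b) / 2}" if B: "positive_bump u a b" for a b
  proof -
    have v: "velocity (- \<kappa>) (p x) = D01 u x" if "x \<in> {a<..<b}" for x
      using vel sub[OF B] that by blast
    have "strict_antimono_on {a<..<b} (D01 u)"
      using positive_bump_velocity_decreasing[OF k assms(4) T B] v by (simp add: monotone_on_def)
    moreover have "{x \<in> {a<..<b}. D01 u x = 0} = {x \<in> {a<..<b}. velocity (- \<kappa>) (p x) = 0}"
      using v by auto
    ultimately show ?thesis
      using positive_bump_symmetric[OF k assms(4) T B] positive_bump_critical_point[OF k assms(4) T B]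
      by simp
  qed
  have neg: "symmetric_bump u a b \<and> strict_mono_on {a<..<b} (D01 u) \<and>
      {x \<in> {a<..<b}. D01 u x = 0} = {(a + b) / 2}" if "negative_bump u a b" for a b
  proof -
    have B: "positive_bump (\<lambda>x. - u x) a b"
      using that by (simp add: negative_bump_def)
    have v: "velocity (- \<kappa>) (- p x) = - D01 u x" if "x \<in> {a<..<b}" for x
      using vel sub[OF B] that by auto
    have "symmetric_bump u a b"
      using positive_bump_symmetric[OF k assms(4) T' B]
      by (simp only: symmetric_bump_def neg_equal_iff_equal)
    moreover have "strict_mono_on {a<..<b} (D01 u)"
    proof (rule monotone_onI)
      fix x y assume "x \<in> {a<..<b}" "y \<in> {a<..<b}" "x < y"
      then show "D01 u x < D01 u y"
        using monotone_onD[OF positive_bump_velocity_decreasing[OF k assms(4) T' B], of x y]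
          v[of x] v[of y] by linarith
    qed
    moreover have "{x \<in> {a<..<b}. D01 u x = 0} = {x \<in> {a<..<b}. velocity (- \<kappa>) (- p x) = 0}"
      using v by auto
    ultimately show ?thesis
      using positive_bump_critical_point[OF k assms(4) T' B] by simp
  qed
  have "is_translate u a b u c d" if "positive_bump u a b" "positive_bump u c d" for a b c d
    using positive_bumps_translate[OF k assms(4) T T refl that] .
  moreover have "is_translate u a b u c d" if "negative_bump u a b" "negative_bump u c d" for a b c d
    using positive_bumps_translate[OF k assms(4) T' T' refl, of a b c d] that
    by (simp add: negative_bump_def is_translate_def)
  ultimately show ?thesis
    using nodal_eigenvalue_bound[OF assms(1,4,2,5)] pos neg opposite
    unfolding same_shape_def same_shape_opposite_def by blast
qed

end
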